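(* Suppose $X$ is a space and $\mathcal I$ is a proper ideal of closed subsets of $X$. If $X$ is functionally $\mathcal I$-normal and $\mathcal I$ consists of $\mathbb R$-bounded sets, then the following are equivalent: (i) For every $\{A_n:n\in\mathbb N\}\subseteq\mathcal I$, there exists $E\in\mathcal I$ such that, for every $n\in\mathbb N$, $E\not\subseteq A_n$. (ii) For every $\{A_n:n\in\mathbb N\}\subseteq\mathcal I$, there exist a family $\{U_n:n\in\mathbb N\}$ of nonempty open subsets of $X$ and $E\in\mathcal I$ such that $E\not\subseteq U_n$ for any $n\in\mathbb N$. (iii) $C_{\mathcal I}(X)$ is not first-countable. (iv) $C_{\mathcal I}(X)$ is not metrizable. (v) $C_{\mathcal I}(X)$ is injectively discretely selective. (vi) $C_{\mathcal I}(X)$ is discretely selective. (vii) $C_{\mathcal I}(X)$ is SHD. (viii) $C_{\mathcal I}(X)$ is WSHD.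
   Context: $\mathbb N$ is the set of positive integers. A space is a nonempty topological space. A family $\mathcal I$ of nonempty closed subsets of $X$ is a proper ideal of closed sets if every $A\in\mathcal I$ is a proper subset of $X$; $A\cup B\in\mathcal I$ for all $A,B\in\mathcal I$; and $\{x\}\in\mathcal I$ for every $x\in X$. $X$ is functionally $\mathcal I$-normal if for every $A\in\mathcal I$ and every open $U\subsetneq X$ with $A\subseteq U$ there is a continuous $f:X\to\mathbb R$ with $f[A]=\{0\}$ and $f[X\setminus U]=\{1\}$. A set $A\subseteq X$ is $\mathbb R$-bounded if $f[A]$ is bounded for every continuous $f:X\to\mathbb R$. $C_{\mathcal I}(X)$ is the set $C(X)$ of continuous real-valued functions on $X$ with the topology generated by the sets $[f;A,\varepsilon]=\{g\in C(X):\sup\{|f(x)-g(x)|:x\in A\}<\varepsilon\}$, where $f\in C(X)$, $A\in\mathcal I$, $\varepsilon>0$. For a space $Y$: a subset $A\subseteq Y$ is closed and relatively discrete if it is closed and for every $y\in A$ there is an open $U$ with $U\cap A=\{y\}$. $Y$ is discretely selective if for every sequence $\langle U_n:n\in\mathbb N\rangle$ of nonempty open subsets of $Y$ there are $y_n\in U_n$ such that $\{y_n:n\in\mathbb N\}$ is closed and relatively discrete in $Y$; $Y$ is injectively discretely selective if for every such sequence there are $y_n\in U_n$ such that $n\mapsto y_n$ is injective and $\{y_n:n\in\mathbb N\}$ is closed and relatively discrete in $Y$. $Y$ is SHD (selectively highly divergent) if for every such sequence there are $y_n\in U_n$ such that $\langle y_n:n\in\mathbb N\rangle$ has no convergent subsequence.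 $Y$ is WSHD (weakly selectively highly divergent) if for every such sequence there are an infinite $A\subseteq\mathbb N$ and $y_n\in U_n$ for $n\in A$ such that $\langle y_n:n\in A\rangle$ has no convergent subsequence.
   Formalization: In (ii) each open set U_n is additionally required to contain A_n; without this, (ii) always holds and the equivalence fails, e.g. for X the discrete positive integers with the ideal of nonempty finite sets. *)

theory Defs
  imports "HOL-Analysis.Analysis"
begin

text \<open>Spaces are abstract topologies. Sequences, which the source indexes by the positive
  integers, are indexed by \<^typ>\<open>nat\<close> throughout.\<close>

definition proper_closed_ideal :: "'a topology \<Rightarrow> 'a set set \<Rightarrow> bool" where
  "proper_closed_ideal X \<I> \<longleftrightarrow>
     (\<forall>A\<in>\<I>. closedin X A \<and> A \<noteq> {} \<and> A \<noteq> topspace X) \<and>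
     (\<forall>A\<in>\<I>. \<forall>B\<in>\<I>. A \<union> B \<in> \<I>) \<and>
     (\<forall>x\<in>topspace X. {x} \<in> \<I>)"

definition functionally_ideal_normal :: "'a topology \<Rightarrow> 'a set set \<Rightarrow> bool" where
  "functionally_ideal_normal X \<I> \<longleftrightarrow>
     (\<forall>A\<in>\<I>. \<forall>U. openin X U \<and> U \<subset> topspace X \<and> A \<subseteq> U \<longrightarrow>
        (\<exists>f. continuous_map X euclideanreal f \<and> f ` A = {0} \<and> f ` (topspace X - U) = {1}))"

definition real_bounded_in :: "'a topology \<Rightarrow> 'a set \<Rightarrow> bool" where
  "real_bounded_in X A \<longleftrightarrow>
     A \<subseteq> topspace X \<and> (\<forall>f. continuous_map X euclideanreal f \<longrightarrow> bounded (f ` A))"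

text \<open>Restricting to extensional functions makes equality in \<open>C_set X\<close> agree with equality of
  functions on the carrier of \<open>X\<close>; otherwise the function space would not be Hausdorff.\<close>

definition C_set :: "'a topology \<Rightarrow> ('a \<Rightarrow> real) set" where
  "C_set X = {f. continuous_map X euclideanreal f \<and> f \<in> extensional (topspace X)}"

text \<open>The supremum is taken in the extended reals, so that it is \<open>\<infinity>\<close> (and hence not below
  \<open>\<epsilon>\<close>) when the difference is unbounded on \<open>A\<close>.\<close>

definition C_nbhd :: "'a topology \<Rightarrow> ('a \<Rightarrow> real) \<Rightarrow> 'a set \<Rightarrow> real \<Rightarrow> ('a \<Rightarrow> real) set" where
  "C_nbhd X f A \<epsilon> = {g \<in> C_set X. (SUP x\<in>A. ereal \<bar>f x - g x\<bar>) < ereal \<epsilon>}"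

definition C_ideal :: "'a topology \<Rightarrow> 'a set set \<Rightarrow> ('a \<Rightarrow> real) topology" where
  "C_ideal X \<I> =
     topology_generated_by {C_nbhd X f A \<epsilon> | f A \<epsilon>. f \<in> C_set X \<and> A \<in> \<I> \<and> \<epsilon> > 0}"

definition closed_relatively_discrete :: "'a topology \<Rightarrow> 'a set \<Rightarrow> bool" where
  "closed_relatively_discrete Y A \<longleftrightarrow>
     closedin Y A \<and> (\<forall>y\<in>A. \<exists>U. openin Y U \<and> U \<inter> A = {y})"

definition nonempty_open_seq :: "'a topology \<Rightarrow> (nat \<Rightarrow> 'a set) \<Rightarrow> bool" where
  "nonempty_open_seq Y U \<longleftrightarrow> (\<forall>n. openin Y (U n) \<and> U n \<noteq> {})"

definition discretely_selective :: "'a topology \<Rightarrow> bool" where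
  "discretely_selective Y \<longleftrightarrow>
     (\<forall>U. nonempty_open_seq Y U \<longrightarrow>
        (\<exists>y. (\<forall>n. y n \<in> U n) \<and> closed_relatively_discrete Y (range y)))"

definition injectively_discretely_selective :: "'a topology \<Rightarrow> bool" where
  "injectively_discretely_selective Y \<longleftrightarrow>
     (\<forall>U. nonempty_open_seq Y U \<longrightarrow>
        (\<exists>y. (\<forall>n. y n \<in> U n) \<and> inj y \<and> closed_relatively_discrete Y (range y)))"

text \<open>\<open>A\<close> is the (infinite) index set of the sequence; the values of \<open>y\<close> outside \<open>A\<close> are
  irrelevant.\<close>

definition has_convergent_subseq_on :: "'a topology \<Rightarrow> nat set \<Rightarrow> (nat \<Rightarrow> 'a) \<Rightarrow> bool" where
  "has_convergent_subseq_on Y A y \<longleftrightarrow>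
     (\<exists>\<phi> l. strict_mono \<phi> \<and> range \<phi> \<subseteq> A \<and> limitin Y (y \<circ> \<phi>) l sequentially)"

definition SHD :: "'a topology \<Rightarrow> bool" where
  "SHD Y \<longleftrightarrow>
     (\<forall>U. nonempty_open_seq Y U \<longrightarrow>
        (\<exists>y. (\<forall>n. y n \<in> U n) \<and> \<not> has_convergent_subseq_on Y UNIV y))"

definition WSHD :: "'a topology \<Rightarrow> bool" where
  "WSHD Y \<longleftrightarrow>
     (\<forall>U. nonempty_open_seq Y U \<longrightarrow>
        (\<exists>A y. infinite A \<and> (\<forall>n\<in>A. y n \<in> U n) \<and> \<not> has_convergent_subseq_on Y A y))"

end

theory Submission
  imports Defs
begin

text \<open>If some countable subfamily \<open>A n\<close> of the ideal is cofinal, then uniform convergence on the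
  \<open>A n\<close> is metrizable; a metrizable space without isolated points fails every one of the selection
  properties, because points chosen from a shrinking neighbourhood base converge. If no countable
  subfamily is cofinal, then the basic neighbourhoods contained in given open sets \<open>U n\<close> constrain
  functions on sets \<open>A n\<close> only, and some \<open>E\<close> in the ideal is contained in none of them. So one can
  choose \<open>y n\<close> in \<open>U n\<close> whose suprema on \<open>E\<close> tend strictly to infinity, and since every
  continuous function is bounded on \<open>E\<close>, these functions form a closed discrete set.\<close>

section \<open>Selection properties of topological spaces\<close>

text \<open>Finite initial intersections of an enumerated local base are nested, so points chosen
  from them converge to \<open>p\<close>.\<close>

lemma first_countable_decseq_base:
  assumes "first_countable Y" and p: "p \<in> topspace Y"
  obtains B :: "nat \<Rightarrow> 'a set" where "\<And>n. openin Y (B n)" "\<And>n. p \<in> B n" "decseq B"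
    "\<And>U. openin Y U \<Longrightarrow> p \<in> U \<Longrightarrow> \<exists>n. B n \<subseteq> U"
proof -
  obtain \<B> where \<B>: "countable \<B>" "\<And>V. V \<in> \<B> \<Longrightarrow> openin Y V"
    "\<And>U. openin Y U \<Longrightarrow> p \<in> U \<Longrightarrow> \<exists>V\<in>\<B>. p \<in> V \<and> V \<subseteq> U"
    using assms unfolding first_countable_def by metis
  define \<C> where "\<C> = {V \<in> \<B>. p \<in> V}"
  have "countable \<C>" "\<C> \<noteq> {}"
    using \<B>(1) \<B>(3)[of "topspace Y"] p by (auto simp: \<C>_def)
  \<comment> \<open>An enumeration with repetitions serves finite and infinite local bases
    alike.\<close>
  then obtain V :: "nat \<Rightarrow> 'a set" where V: "range V = \<C>"
    using range_from_nat_into by metis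
  define B where "B n = (\<Inter>i\<le>n. V i)" for n
  have V': "openin Y (V i)" "p \<in> V i" for i
    using V \<B>(2) by (auto simp: \<C>_def)
  show thesis
  proof (rule that)
    show "openin Y (B n)" for n
      using V' by (auto simp: B_def intro!: openin_INT2)
    show "p \<in> B n" for n
      using V' by (auto simp: B_def)
    show "decseq B"
      by (force simp: decseq_def B_def)
    show "\<exists>n. B n \<subseteq> U" if U: "openin Y U" "p \<in> U" for U
    proof -
      obtain W where "W \<in> \<C>" "W \<subseteq> U"
        using \<B>(3)[OF U] by (auto simp: \<C>_def)
      then obtain n where "V n \<subseteq> U"
        using V by blast
      then show ?thesis
        by (auto simp: B_def)
    qed
  qed
qed

text \<open>Membership is asked only at the indices \<open>\<phi> n\<close>, because a selection
  over an infinite index set leaves the other values of \<open>y\<close> arbitrary. As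
  \<open>k \<le> \<phi> k\<close>, the later sets lie in any prescribed \<open>B n\<close>.\<close>

lemma limitin_decseq_base:
  assumes "p \<in> topspace Y" "decseq B" "strict_mono \<phi>"
    and base: "\<And>U. openin Y U \<Longrightarrow> p \<in> U \<Longrightarrow> \<exists>n. B n \<subseteq> U"
    and y: "\<And>n. y (\<phi> n) \<in> B (\<phi> n)"
  shows "limitin Y (y \<circ> \<phi>) p sequentially"
  unfolding limitin_def
proof (intro conjI allI impI)
  fix U assume "openin Y U \<and> p \<in> U"
  then obtain n where n: "B n \<subseteq> U"
    using base by blast
  have "y (\<phi> k) \<in> U" if "k \<ge> n" for k
  proof -
    have "n \<le> \<phi> k"
      using that seq_suble[OF \<open>strict_mono \<phi>\<close>, of k] by simp
    then show ?thesis
      using n y \<open>decseq B\<close> unfolding decseq_def by blast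
  qed
  then show "\<forall>\<^sub>F k in sequentially. (y \<circ> \<phi>) k \<in> U"
    by (auto simp: eventually_sequentially)
qed fact

text \<open>Selections from a nested local base at \<open>p\<close> cannot avoid convergence:
  listing the infinite index set in increasing order yields a sequence tending to
  \<open>p\<close>.\<close>

lemma WSHD_imp_not_first_countable:
  assumes "WSHD Y" "topspace Y \<noteq> {}"
  shows "\<not> first_countable Y"
proof
  assume fc: "first_countable Y"
  obtain p where p: "p \<in> topspace Y"
    using assms by blast
  obtain B where B: "\<And>n. openin Y (B n)" "\<And>n. p \<in> B n" "decseq B"
    "\<And>U. openin Y U \<Longrightarrow> p \<in> U \<Longrightarrow> \<exists>n. B n \<subseteq> U"
    using first_countable_decseq_base[OF fc p] by metis
  have "nonempty_open_seq Y B"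
    using B(1,2) unfolding nonempty_open_seq_def by blast
  then obtain A y where A: "infinite A" "\<And>n. n \<in> A \<Longrightarrow> y n \<in> B n"
    "\<not> has_convergent_subseq_on Y A y"
    using \<open>WSHD Y\<close>[unfolded WSHD_def, THEN spec, of B] by auto
  have e: "strict_mono (enumerate A)" "range (enumerate A) = A"
    using A(1) strict_mono_enumerate range_enumerate by auto
  moreover have "limitin Y (y \<circ> enumerate A) p sequentially"
    using p B(3) e(1) B(4)
  proof (rule limitin_decseq_base)
    show "y (enumerate A n) \<in> B (enumerate A n)" for n
      using A(2) e(2) by blast
  qed
  ultimately show False
    using A(3) unfolding has_convergent_subseq_on_def by blast
qed

text \<open>The local base is punctured at \<open>p\<close>, since otherwise the constant choice
  \<open>p\<close> would have a closed discrete range. The T1 axiom keeps the punctured sets open,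
  and accumulation at \<open>p\<close> keeps them nonempty.\<close>

lemma discretely_selective_imp_not_first_countable:
  assumes ds: "discretely_selective Y" and "t1_space Y"
    and p: "p \<in> Y derived_set_of (topspace Y)"
  shows "\<not> first_countable Y"
proof
  assume fc: "first_countable Y"
  have pY: "p \<in> topspace Y"
    using p by (simp add: in_derived_set_of)
  obtain B where B: "\<And>n. openin Y (B n)" "\<And>n. p \<in> B n" "decseq B"
    "\<And>U. openin Y U \<Longrightarrow> p \<in> U \<Longrightarrow> \<exists>n. B n \<subseteq> U"
    using first_countable_decseq_base[OF fc pY] by metis
  have "nonempty_open_seq Y (\<lambda>n. B n - {p})"
    unfolding nonempty_open_seq_def
  proof (intro allI conjI)
    fix n
    show "openin Y (B n - {p})"
      using B(1) \<open>t1_space Y\<close> by (simp add: openin_diff closedin_t1_singleton pY)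
    show "B n - {p} \<noteq> {}"
      using p B(1)[of n] B(2)[of n] unfolding in_derived_set_of by blast
  qed
  then obtain y where y: "\<And>n. y n \<in> B n - {p}" "closedin Y (range y)"
    using ds[unfolded discretely_selective_def, THEN spec, of "\<lambda>n. B n - {p}"]
    by (auto simp: closed_relatively_discrete_def)
  \<comment> \<open>A closed range omitting \<open>p\<close> leaves a whole \<open>B n\<close> free
    of chosen points, although \<open>y n\<close> lies in \<open>B n\<close>.\<close>
  have "openin Y (topspace Y - range y)" "p \<in> topspace Y - range y"
    using y pY by blast+
  then obtain n where "B n \<subseteq> topspace Y - range y"
    using B(4) by blast
  then show False
    using y(1) by blast
qed

section \<open>Implications among the selection properties\<close>

lemma injectively_discretely_selective_imp_discretely_selective:
  "injectively_discretely_selective Y \<Longrightarrow> discretely_selective Y"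
  unfolding injectively_discretely_selective_def discretely_selective_def
proof (intro allI impI)
  fix U assume "\<forall>U. nonempty_open_seq Y U \<longrightarrow>
      (\<exists>y. (\<forall>n. y n \<in> U n) \<and> inj y \<and> closed_relatively_discrete Y (range y))"
    and "nonempty_open_seq Y U"
  then have "\<exists>y. (\<forall>n. y n \<in> U n) \<and> inj y \<and> closed_relatively_discrete Y (range y)"
    by (elim allE impE)
  then show "\<exists>y. (\<forall>n. y n \<in> U n) \<and> closed_relatively_discrete Y (range y)"
    by (elim ex_forward conj_forward) auto
qed

lemma SHD_imp_WSHD: "SHD Y \<Longrightarrow> WSHD Y"
  unfolding SHD_def WSHD_def
proof (intro allI impI)
  fix U assume "\<forall>U. nonempty_open_seq Y U \<longrightarrow>
      (\<exists>y. (\<forall>n. y n \<in> U n) \<and> \<not> has_convergent_subseq_on Y UNIV y)"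
    and "nonempty_open_seq Y U"
  then have "\<exists>y. (\<forall>n. y n \<in> U n) \<and> \<not> has_convergent_subseq_on Y UNIV y"
    by (elim allE impE)
  then show "\<exists>A y. infinite A \<and> (\<forall>n\<in>A. y n \<in> U n) \<and> \<not> has_convergent_subseq_on Y A y"
    by (intro exI[of _ UNIV]) auto
qed

text \<open>A limit must lie in the closed range, and a neighbourhood isolating it there makes the
  subsequence eventually constant, which injectivity forbids.\<close>

lemma no_convergent_subseq_closed_relatively_discrete:
  assumes "inj y" "closed_relatively_discrete Y (range y)"
  shows "\<not> has_convergent_subseq_on Y S y"
  unfolding has_convergent_subseq_on_def
proof (intro notI, elim exE conjE)
  fix \<phi> l assume \<phi>: "strict_mono \<phi>" and lim: "limitin Y (y \<circ> \<phi>) l sequentially"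
  have "l \<in> range y"
    using limitin_closedin[OF lim, of "range y"] assms(2)
    by (auto simp: closed_relatively_discrete_def)
  then obtain U where U: "openin Y U" "U \<inter> range y = {l}"
    using assms(2) unfolding closed_relatively_discrete_def by blast
  then have "\<forall>\<^sub>F k in sequentially. y (\<phi> k) \<in> U"
    using lim unfolding limitin_def by auto
  then obtain n where "\<And>k. k \<ge> n \<Longrightarrow> y (\<phi> k) \<in> U"
    by (auto simp: eventually_sequentially)
  then have "\<And>k. k \<ge> n \<Longrightarrow> y (\<phi> k) = l"
    using U(2) by blast
  then have "y (\<phi> n) = y (\<phi> (Suc n))"
    by simp
  then show False
    using \<open>inj y\<close> \<phi> by (metis injD lessI less_irrefl strict_monoD)
qed

lemma injectively_discretely_selective_imp_SHD:
  "injectively_discretely_selective Y \<Longrightarrow> SHD Y"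
  unfolding injectively_discretely_selective_def SHD_def
proof (intro allI impI)
  fix U assume "\<forall>U. nonempty_open_seq Y U \<longrightarrow>
      (\<exists>y. (\<forall>n. y n \<in> U n) \<and> inj y \<and> closed_relatively_discrete Y (range y))"
    and "nonempty_open_seq Y U"
  then have "\<exists>y. (\<forall>n. y n \<in> U n) \<and> inj y \<and> closed_relatively_discrete Y (range y)"
    by (elim allE impE)
  then show "\<exists>y. (\<forall>n. y n \<in> U n) \<and> \<not> has_convergent_subseq_on Y UNIV y"
    by (elim ex_forward conj_forward) (auto dest: no_convergent_subseq_closed_relatively_discrete)
qed

text \<open>In a T1 space every neighbourhood of an accumulation point meets the set infinitely
  often, so local finiteness excludes accumulation points both in \<open>S\<close> and outside
  it.\<close>

lemma closed_relatively_discreteI: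
  assumes "t1_space Y" "S \<subseteq> topspace Y"
    and fin: "\<And>p. p \<in> topspace Y \<Longrightarrow> \<exists>U. openin Y U \<and> p \<in> U \<and> finite (U \<inter> S)"
  shows "closed_relatively_discrete Y S"
proof -
  have no_acc: "Y derived_set_of S = {}"
  proof -
    have "\<not> infinite (U \<inter> S) \<Longrightarrow> p \<notin> Y derived_set_of S" if "openin Y U" "p \<in> U" for p U
      using assms(1) that by (auto simp: t1_space_derived_set_of_infinite_openin Int_commute)
    then show ?thesis
      using fin by (metis (no_types, opaque_lifting) equals0I in_derived_set_of)
  qed
  show ?thesis
    unfolding closed_relatively_discrete_def
  proof (intro conjI ballI)
    show "closedin Y S"
      using no_acc assms(2) by (simp add: closedin_contains_derived_set)
    fix q assume "q \<in> S"
    moreover have "q \<notin> Y derived_set_of S"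
      by (simp add: no_acc)
    ultimately show "\<exists>U. openin Y U \<and> U \<inter> S = {q}"
      using assms(2) unfolding in_derived_set_of by blast
  qed
qed

section \<open>The topology of uniform convergence on an ideal\<close>

text \<open>Trades the extended-real supremum for a real bound, found by density between the
  supremum and \<open>\<epsilon>\<close>. The bound must be uniform: a pointwise
  \<open>< \<epsilon>\<close> would still allow the supremum to equal
  \<open>\<epsilon>\<close>.\<close>

lemma in_C_nbhd_iff:
  "g \<in> C_nbhd X f A \<epsilon> \<longleftrightarrow> g \<in> C_set X \<and> (\<exists>\<delta><\<epsilon>. \<forall>x\<in>A. \<bar>f x - g x\<bar> \<le> \<delta>)"
proof -
  have "(SUP x\<in>A. ereal \<bar>f x - g x\<bar>) < ereal \<epsilon> \<longleftrightarrow> (\<exists>\<delta><\<epsilon>. \<forall>x\<in>A. \<bar>f x - g x\<bar> \<le> \<delta>)"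
    (is "?s < _ \<longleftrightarrow> ?R")
  proof
    assume "?s < ereal \<epsilon>"
    then obtain \<delta> where \<delta>: "?s < ereal \<delta>" "\<delta> < \<epsilon>"
      using ereal_dense2 by fastforce
    then have "ereal \<bar>f x - g x\<bar> \<le> ereal \<delta>" if "x \<in> A" for x
      using that by (meson SUP_upper less_imp_le order_trans)
    then show ?R
      using \<delta>(2) by auto
  next
    assume ?R
    then obtain \<delta> where "\<delta> < \<epsilon>" "\<And>x. x \<in> A \<Longrightarrow> \<bar>f x - g x\<bar> \<le> \<delta>"
      by blast
    then have "?s \<le> ereal \<delta>"
      by (intro SUP_least) simp
    also have "\<dots> < ereal \<epsilon>"
      using \<open>\<delta> < \<epsilon>\<close> by simp
    finally show "?s < ereal \<epsilon>" .
  qed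
  then show ?thesis
    by (simp add: C_nbhd_def)
qed

lemma in_C_nbhd_self: "f \<in> C_set X \<Longrightarrow> 0 < \<epsilon> \<Longrightarrow> f \<in> C_nbhd X f A \<epsilon>"
  by (auto simp: in_C_nbhd_iff)

lemma C_nbhd_mono: "A \<subseteq> B \<Longrightarrow> \<epsilon> \<le> \<epsilon>' \<Longrightarrow> C_nbhd X f B \<epsilon> \<subseteq> C_nbhd X f A \<epsilon>'"
  by (force simp: in_C_nbhd_iff)

text \<open>By the triangle inequality, the slack \<open>\<epsilon> - \<delta>\<close> left at
  \<open>g\<close> is a suitable radius.\<close>

lemma C_nbhd_shrink:
  assumes "g \<in> C_nbhd X f A \<epsilon>"
  shows "\<exists>\<epsilon>'>0. C_nbhd X g A \<epsilon>' \<subseteq> C_nbhd X f A \<epsilon>"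
proof -
  obtain \<delta> where \<delta>: "\<delta> < \<epsilon>" "\<And>x. x \<in> A \<Longrightarrow> \<bar>f x - g x\<bar> \<le> \<delta>"
    using assms by (auto simp: in_C_nbhd_iff)
  have "h \<in> C_nbhd X f A \<epsilon>" if h: "h \<in> C_nbhd X g A (\<epsilon> - \<delta>)" for h
  proof -
    obtain \<eta> where "\<eta> < \<epsilon> - \<delta>" "\<And>x. x \<in> A \<Longrightarrow> \<bar>g x - h x\<bar> \<le> \<eta>"
      using h by (auto simp: in_C_nbhd_iff)
    then have "\<delta> + \<eta> < \<epsilon>" "\<forall>x\<in>A. \<bar>f x - h x\<bar> \<le> \<delta> + \<eta>"
      using \<delta>(2) by force+
    then show ?thesis
      using h by (auto simp: in_C_nbhd_iff)
  qed
  then show ?thesis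
    using \<delta>(1) by (intro exI[of _ "\<epsilon> - \<delta>"]) auto
qed

lemma proper_closed_ideal_nonempty:
  assumes "proper_closed_ideal X \<I>" "topspace X \<noteq> {}"
  shows "\<I> \<noteq> {}"
  using assms unfolding proper_closed_ideal_def by blast

text \<open>Unions in the ideal absorb finite intersections of generating sets, and recentring by
  \<open>C_nbhd_shrink\<close> lets every neighbourhood be centred at the point itself.\<close>

lemma openin_C_ideal:
  assumes "\<I> \<noteq> {}" and Un: "\<And>A B. A \<in> \<I> \<Longrightarrow> B \<in> \<I> \<Longrightarrow> A \<union> B \<in> \<I>"
  shows "openin (C_ideal X \<I>) W \<longleftrightarrow>
    W \<subseteq> C_set X \<and> (\<forall>f\<in>W. \<exists>A\<in>\<I>. \<exists>\<epsilon>>0. C_nbhd X f A \<epsilon> \<subseteq> W)"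
proof -
  let ?S = "{C_nbhd X f A \<epsilon> | f A \<epsilon>. f \<in> C_set X \<and> A \<in> \<I> \<and> \<epsilon> > 0}"
  have "W \<subseteq> C_set X \<and> (\<forall>f\<in>W. \<exists>A\<in>\<I>. \<exists>\<epsilon>>0. C_nbhd X f A \<epsilon> \<subseteq> W)"
    if "generate_topology_on ?S W"
    using that
  proof induction
    case Empty
    then show ?case by simp
  next
    case (Int a b)
    have "\<exists>A\<in>\<I>. \<exists>\<epsilon>>0. C_nbhd X f A \<epsilon> \<subseteq> a \<inter> b" if f: "f \<in> a \<inter> b" for f
    proof -
      obtain A \<epsilon> B \<delta> where AB: "A \<in> \<I>" "\<epsilon> > 0" "C_nbhd X f A \<epsilon> \<subseteq> a"
        "B \<in> \<I>" "\<delta> > 0" "C_nbhd X f B \<delta> \<subseteq> b"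
        using Int.IH f by (metis IntD1 IntD2)
      have "C_nbhd X f (A \<union> B) (min \<epsilon> \<delta>) \<subseteq> C_nbhd X f A \<epsilon>"
        "C_nbhd X f (A \<union> B) (min \<epsilon> \<delta>) \<subseteq> C_nbhd X f B \<delta>"
        by (rule C_nbhd_mono; simp)+
      then have "C_nbhd X f (A \<union> B) (min \<epsilon> \<delta>) \<subseteq> a \<inter> b"
        using AB by blast
      then show ?thesis
        using AB Un by (metis min_less_iff_conj)
    qed
    then show ?case
      using Int.IH by blast
  next
    case (UN K)
    then show ?case
      by (meson Union_iff Union_least Union_upper order_trans)
  next
    case (Basis s)
    then obtain f A \<epsilon> where s: "s = C_nbhd X f A \<epsilon>" "A \<in> \<I>"
      by blast
    then show ?case
      using C_nbhd_shrink[of _ X f A \<epsilon>] in_C_nbhd_iff[of _ X f A \<epsilon>] by blast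
  qed
  moreover have "generate_topology_on ?S W"
    if W: "W \<subseteq> C_set X" "\<forall>f\<in>W. \<exists>A\<in>\<I>. \<exists>\<epsilon>>0. C_nbhd X f A \<epsilon> \<subseteq> W"
  proof -
    have "W = \<Union>{V \<in> ?S. V \<subseteq> W}"
    proof (intro equalityI subsetI)
      fix f assume f: "f \<in> W"
      then obtain A \<epsilon> where "A \<in> \<I>" "\<epsilon> > 0" "C_nbhd X f A \<epsilon> \<subseteq> W"
        using W by blast
      moreover have "f \<in> C_set X"
        using f W by blast
      ultimately show "f \<in> \<Union>{V \<in> ?S. V \<subseteq> W}"
        using in_C_nbhd_self by blast
    qed blast
    moreover have "generate_topology_on ?S (\<Union>{V \<in> ?S. V \<subseteq> W})"
      by (rule generate_topology_on.UN) (blast intro: generate_topology_on.Basis)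
    ultimately show ?thesis
      by simp
  qed
  ultimately show ?thesis
    unfolding C_ideal_def openin_topology_generated_by_iff by blast
qed

lemma openin_C_nbhd: "f \<in> C_set X \<Longrightarrow> A \<in> \<I> \<Longrightarrow> \<epsilon> > 0 \<Longrightarrow> openin (C_ideal X \<I>) (C_nbhd X f A \<epsilon>)"
  unfolding C_ideal_def by (rule topology_generated_by_Basis) blast

lemma topspace_C_ideal:
  assumes "\<I> \<noteq> {}"
  shows "topspace (C_ideal X \<I>) = C_set X"
proof (intro equalityI subsetI)
  fix f assume f: "f \<in> C_set X"
  obtain A where "A \<in> \<I>"
    using assms by blast
  then have "f \<in> C_nbhd X f A 1" "openin (C_ideal X \<I>) (C_nbhd X f A 1)"
    using f by (auto intro: in_C_nbhd_self openin_C_nbhd)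
  then show "f \<in> topspace (C_ideal X \<I>)"
    using openin_subset by blast
qed (auto simp: C_ideal_def in_C_nbhd_iff)

section \<open>Separation and absence of isolated points\<close>

lemma C_set_ext: "f \<in> C_set X \<Longrightarrow> g \<in> C_set X \<Longrightarrow> (\<And>x. x \<in> topspace X \<Longrightarrow> f x = g x) \<Longrightarrow> f = g"
  unfolding C_set_def by (blast intro: extensionalityI)

lemma restrict_in_C_set:
  "continuous_map X euclideanreal f \<Longrightarrow> restrict f (topspace X) \<in> C_set X"
  unfolding C_set_def by (auto intro: continuous_map_eq)

lemma C_set_continuous: "f \<in> C_set X \<Longrightarrow> continuous_map X euclideanreal f"
  by (simp add: C_set_def)

text \<open>Distinct functions differ at a point \<open>x\<close>, and \<open>{x}\<close> is in the
  ideal. The radius \<open>\<bar>f x - g x\<bar>\<close> excludes \<open>g\<close> because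
  neighbourhoods are defined by a strict inequality.\<close>

lemma t1_space_C_ideal:
  assumes "\<I> \<noteq> {}" and sing: "\<And>x. x \<in> topspace X \<Longrightarrow> {x} \<in> \<I>"
  shows "t1_space (C_ideal X \<I>)"
  unfolding t1_space_def topspace_C_ideal[OF \<open>\<I> \<noteq> {}\<close>]
proof (intro ballI impI)
  fix f g assume fg: "f \<in> C_set X" "g \<in> C_set X" "f \<noteq> g"
  then obtain x where x: "x \<in> topspace X" "f x \<noteq> g x"
    using C_set_ext by blast
  let ?U = "C_nbhd X f {x} \<bar>f x - g x\<bar>"
  have "openin (C_ideal X \<I>) ?U \<and> f \<in> ?U \<and> g \<notin> ?U"
    using fg x sing by (simp add: openin_C_nbhd in_C_nbhd_self) (auto simp: in_C_nbhd_iff)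
  then show "\<exists>U. openin (C_ideal X \<I>) U \<and> f \<in> U \<and> g \<notin> U"
    by blast
qed

text \<open>Adding the constant \<open>\<epsilon> / 2\<close> changes \<open>f\<close> without
  leaving the given neighbourhood, whatever its set \<open>A\<close> is.\<close>

lemma derived_set_of_C_ideal:
  assumes "\<I> \<noteq> {}" and Un: "\<And>A B. A \<in> \<I> \<Longrightarrow> B \<in> \<I> \<Longrightarrow> A \<union> B \<in> \<I>"
    and X: "topspace X \<noteq> {}" and f: "f \<in> C_set X"
  shows "f \<in> C_ideal X \<I> derived_set_of (topspace (C_ideal X \<I>))"
  unfolding in_derived_set_of topspace_C_ideal[OF \<open>\<I> \<noteq> {}\<close>]
proof (intro conjI allI impI)
  fix T assume "f \<in> T \<and> openin (C_ideal X \<I>) T"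
  then obtain A \<epsilon> where T: "\<epsilon> > 0" "C_nbhd X f A \<epsilon> \<subseteq> T"
    using openin_C_ideal[OF assms(1,2)] by blast
  define g where "g = restrict (\<lambda>x. f x + \<epsilon> / 2) (topspace X)"
  have g: "g \<in> C_set X"
    unfolding g_def using C_set_continuous[OF f]
    by (intro restrict_in_C_set continuous_map_add) auto
  have f_out: "f x = undefined" if "x \<notin> topspace X" for x
    using f that by (auto simp: C_set_def extensional_def)
  \<comment> \<open>Outside the carrier both functions take the value \<open>undefined\<close>, so
    the estimate holds at every \<open>x\<close>.\<close>
  have "\<bar>f x - g x\<bar> \<le> \<epsilon> / 2" for x
    using \<open>\<epsilon> > 0\<close> f_out by (cases "x \<in> topspace X") (auto simp: g_def)
  then have "g \<in> C_nbhd X f A \<epsilon>"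
    using g \<open>\<epsilon> > 0\<close> unfolding in_C_nbhd_iff by (metis field_sum_of_halves less_add_same_cancel1 half_gt_zero)
  moreover have "g \<noteq> f"
  proof -
    obtain x where "x \<in> topspace X"
      using X by blast
    then have "g x \<noteq> f x"
      using \<open>\<epsilon> > 0\<close> by (simp add: g_def)
    then show ?thesis
      by auto
  qed
  ultimately show "\<exists>h. h \<noteq> f \<and> h \<in> C_set X \<and> h \<in> T"
    using g T by blast
qed fact

section \<open>Ideals with a countable cofinal family\<close>

text \<open>For increasing sets \<open>A n\<close> covering the space, a weight that decreases to 0 along the \<open>A n\<close>
  turns uniform convergence on all \<open>A n\<close> into uniform convergence for the truncated differences.\<close>

lemma metrizable_C_ideal:
  assumes "\<I> \<noteq> {}" and Un: "\<And>A B. A \<in> \<I> \<Longrightarrow> B \<in> \<I> \<Longrightarrow> A \<union> B \<in> \<I>"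
    and sub: "\<And>A. A \<in> \<I> \<Longrightarrow> A \<subseteq> topspace X"
    and sing: "\<And>x. x \<in> topspace X \<Longrightarrow> {x} \<in> \<I>"
    and X: "topspace X \<noteq> {}"
    and A: "\<And>n. A n \<in> \<I>" and cofinal: "\<And>E. E \<in> \<I> \<Longrightarrow> \<exists>n::nat. E \<subseteq> A n"
  shows "metrizable_space (C_ideal X \<I>)"
proof -
  \<comment> \<open>The cofinal sets need not increase; their partial unions do, and they stay in
    the ideal.\<close>
  define B where "B n = (\<Union>i\<le>n. A i)" for n
  have B: "B n \<in> \<I>" for n
  proof (induction n)
    case 0
    then show ?case by (simp add: B_def A)
  next
    case (Suc n)
    have "B (Suc n) = A (Suc n) \<union> B n"
      by (auto simp: B_def atMost_Suc)
    then show ?case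
      using Un A Suc by simp
  qed
  have B_cofinal: "\<exists>n. E \<subseteq> B n" if "E \<in> \<I>" for E
    using cofinal[OF that] by (fastforce simp: B_def)
  have B_mono: "B m \<subseteq> B n" if "m \<le> n" for m n
    using that by (force simp: B_def)
  have B_cover: "\<exists>n. x \<in> B n" if "x \<in> topspace X" for x
    using B_cofinal[OF sing[OF that]] by auto
  \<comment> \<open>The weight depends on the first index at which \<open>x\<close> enters the
    \<open>B n\<close>: at least \<open>1 / Suc n\<close> on \<open>B n\<close>, at most that off
    it. It is positive even where \<open>LEAST\<close> has no witness.\<close>
  define w :: "'a \<Rightarrow> real" where "w x = 1 / (Suc (LEAST n. x \<in> B n))" for x
  have w_pos: "0 < w x" and w_le: "w x \<le> 1" for x
    by (auto simp: w_def)
  have w_in: "1 / Suc n \<le> w x" if "x \<in> B n" for x n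
    using Least_le[of "\<lambda>n. x \<in> B n", OF that] unfolding w_def
    by (intro divide_left_mono) auto
  have w_out: "w x \<le> 1 / Suc n" if x: "x \<in> topspace X" "x \<notin> B n" for x n
  proof -
    have "x \<in> B (LEAST n. x \<in> B n)"
      using B_cover[OF x(1)] by (rule LeastI_ex)
    then have "n \<le> (LEAST n. x \<in> B n)"
      using x(2) B_mono by (metis nat_le_linear subsetD)
    then show ?thesis
      unfolding w_def by (intro divide_left_mono) auto
  qed
  \<comment> \<open>Truncating at \<open>w x \<le> 1\<close> keeps the supremum finite even when the
    difference of the functions is unbounded.\<close>
  define d where "d f g = (SUP x\<in>topspace X. min (w x) \<bar>f x - g x\<bar>)" for f g :: "'a \<Rightarrow> real"
  have bdd: "bdd_above ((\<lambda>x. min (w x) \<bar>f x - g x\<bar>) ` topspace X)" for f g :: "'a \<Rightarrow> real"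
    using w_le by (intro bdd_aboveI[of _ 1]) (auto simp: min_le_iff_disj)
  have d_ge: "min (w x) \<bar>f x - g x\<bar> \<le> d f g" if "x \<in> topspace X" for f g x
    unfolding d_def using that bdd by (rule cSUP_upper)
  have d_le: "d f g \<le> c" if "\<And>x. x \<in> topspace X \<Longrightarrow> min (w x) \<bar>f x - g x\<bar> \<le> c" for f g c
    unfolding d_def using X that by (rule cSUP_least)
  have d_nonneg: "0 \<le> d f g" for f g
  proof -
    obtain x where x: "x \<in> topspace X"
      using X by blast
    have "0 \<le> min (w x) \<bar>f x - g x\<bar>"
      using w_pos[of x] by simp
    then show ?thesis
      using d_ge[OF x, of f g] by linarith
  qed
  interpret M: Metric_space "C_set X" d
  proof
    show "0 \<le> d f g" for f g
      by (rule d_nonneg)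
    show "d f g = d g f" for f g
      by (simp add: d_def abs_minus_commute)
    show "d f g = 0 \<longleftrightarrow> f = g" if fg: "f \<in> C_set X" "g \<in> C_set X" for f g
    proof
      assume 0: "d f g = 0"
      have "f x = g x" if "x \<in> topspace X" for x
        using d_ge[OF that, of f g] w_pos[of x] 0 by (auto simp: min_le_iff_disj)
      then show "f = g"
        using fg C_set_ext by blast
    next
      assume "f = g"
      then have "d f g \<le> 0"
        using w_pos by (intro d_le) auto
      then show "d f g = 0"
        using d_nonneg[of f g] by simp
    qed
    show "d f h \<le> d f g + d g h" for f g h
    proof (rule d_le)
      fix x assume x: "x \<in> topspace X"
      \<comment> \<open>Truncation at a positive level is subadditive, which gives the triangle
        inequality.\<close>
      have "min (w x) \<bar>f x - h x\<bar> \<le> min (w x) \<bar>f x - g x\<bar> + min (w x) \<bar>g x - h x\<bar>"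
        using w_pos[of x] by (auto simp: min_def)
      then show "min (w x) \<bar>f x - h x\<bar> \<le> d f g + d g h"
        using d_ge[OF x, of f g] d_ge[OF x, of g h] by linarith
    qed
  qed
  have nbhd_in_ball: "\<exists>E\<in>\<I>. \<exists>\<epsilon>>0. C_nbhd X f E \<epsilon> \<subseteq> M.mball f r"
    if f: "f \<in> C_set X" and "r > 0" for f r
  proof -
    \<comment> \<open>Off \<open>B n\<close> the weight alone keeps the terms below
      \<open>r\<close>; on \<open>B n\<close> closeness of the functions does.\<close>
    obtain n where n: "1 / Suc n < r"
      using \<open>r > 0\<close> nat_approx_posE by blast
    have "C_nbhd X f (B n) r \<subseteq> M.mball f r"
    proof
      fix g assume g: "g \<in> C_nbhd X f (B n) r"
      then obtain \<delta> where \<delta>: "\<delta> < r" "\<And>x. x \<in> B n \<Longrightarrow> \<bar>f x - g x\<bar> \<le> \<delta>"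
        by (auto simp: in_C_nbhd_iff)
      have "d f g \<le> max \<delta> (1 / Suc n)"
      proof (rule d_le)
        fix x assume "x \<in> topspace X"
        then show "min (w x) \<bar>f x - g x\<bar> \<le> max \<delta> (1 / Suc n)"
          using \<delta>(2)[of x] w_out[of x n] by (cases "x \<in> B n") linarith+
      qed
      also have "\<dots> < r"
        using \<delta>(1) n by simp
      finally show "g \<in> M.mball f r"
        using f g by (simp add: in_C_nbhd_iff)
    qed
    then show ?thesis
      using B \<open>r > 0\<close> by blast
  qed
  have ball_in_nbhd: "\<exists>r>0. M.mball f r \<subseteq> C_nbhd X f E \<epsilon>" if E: "E \<in> \<I>" and "\<epsilon> > 0" for f E \<epsilon>
  proof -
    obtain n where n: "E \<subseteq> B n"
      using B_cofinal[OF E] by blast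
    \<comment> \<open>Below \<open>1 / Suc n\<close> the truncation is inactive on \<open>E\<close>,
      so \<open>d f g\<close> itself is the uniform bound required there.\<close>
    define r where "r = min \<epsilon> (1 / Suc n)"
    have "M.mball f r \<subseteq> C_nbhd X f E \<epsilon>"
    proof
      fix g assume g: "g \<in> M.mball f r"
      have "\<bar>f x - g x\<bar> \<le> d f g" if "x \<in> E" for x
      proof -
        have "min (w x) \<bar>f x - g x\<bar> \<le> d f g"
          using sub[OF E] that by (intro d_ge) blast
        moreover have "1 / Suc n \<le> w x"
          using n that by (intro w_in) blast
        moreover have "d f g < 1 / Suc n"
          using g by (simp add: r_def)
        ultimately show ?thesis
          by linarith
      qed
      then show "g \<in> C_nbhd X f E \<epsilon>"
        using g by (auto simp: in_C_nbhd_iff r_def)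
    qed
    moreover have "r > 0"
      using \<open>\<epsilon> > 0\<close> by (simp add: r_def)
    ultimately show ?thesis
      by blast
  qed
  have ball_iff_nbhd: "(\<exists>r>0. M.mball f r \<subseteq> W) \<longleftrightarrow> (\<exists>E\<in>\<I>. \<exists>\<epsilon>>0. C_nbhd X f E \<epsilon> \<subseteq> W)"
    if f: "f \<in> C_set X" for f W
  proof
    assume "\<exists>r>0. M.mball f r \<subseteq> W"
    then obtain r where "r > 0" "M.mball f r \<subseteq> W"
      by blast
    then show "\<exists>E\<in>\<I>. \<exists>\<epsilon>>0. C_nbhd X f E \<epsilon> \<subseteq> W"
      using nbhd_in_ball[OF f] by (meson order_trans)
  next
    assume "\<exists>E\<in>\<I>. \<exists>\<epsilon>>0. C_nbhd X f E \<epsilon> \<subseteq> W"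
    then obtain E \<epsilon> where "E \<in> \<I>" "\<epsilon> > 0" "C_nbhd X f E \<epsilon> \<subseteq> W"
      by blast
    then show "\<exists>r>0. M.mball f r \<subseteq> W"
      using ball_in_nbhd[of E \<epsilon> f] by (meson order_trans)
  qed
  have "openin M.mtopology W \<longleftrightarrow> openin (C_ideal X \<I>) W" for W
  proof -
    have "openin (C_ideal X \<I>) W \<longleftrightarrow>
        W \<subseteq> C_set X \<and> (\<forall>f\<in>W. \<exists>E\<in>\<I>. \<exists>\<epsilon>>0. C_nbhd X f E \<epsilon> \<subseteq> W)"
      using assms(1) Un by (rule openin_C_ideal)
    also have "\<dots> \<longleftrightarrow> W \<subseteq> C_set X \<and> (\<forall>f\<in>W. \<exists>r>0. M.mball f r \<subseteq> W)"
      by (intro conj_cong ball_cong refl ball_iff_nbhd[symmetric]) blast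
    also have "\<dots> \<longleftrightarrow> openin M.mtopology W"
      unfolding M.openin_mtopology Ball_def ..
    finally show ?thesis
      by (rule sym)
  qed
  then have "M.mtopology = C_ideal X \<I>"
    by (simp add: topology_eq)
  then show ?thesis
    using M.metrizable_space_mtopology by simp
qed

section \<open>Ideals without a countable cofinal family\<close>

text \<open>Normality for \<open>A\<close> inside the complement of \<open>x\<close> gives a
  function \<open>h\<close> that is 0 on \<open>A\<close> and 1 at \<open>x\<close>; a multiple of
  it corrects \<open>f\<close> at \<open>x\<close> alone without disturbing
  \<open>A\<close>.\<close>

lemma C_set_prescribe_value:
  assumes "functionally_ideal_normal X \<I>" "A \<in> \<I>"
    and sub: "A \<subseteq> topspace X" and x: "closedin X {x}" "x \<notin> A" and f: "f \<in> C_set X"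
  shows "\<exists>g\<in>C_set X. (\<forall>z\<in>A. g z = f z) \<and> g x = c"
proof -
  have xX: "x \<in> topspace X"
    using closedin_subset[OF x(1)] by simp
  have "openin X (topspace X - {x})" "topspace X - {x} \<subset> topspace X" "A \<subseteq> topspace X - {x}"
    using x xX sub by blast+
  then obtain h where h: "continuous_map X euclideanreal h" "h ` A = {0}"
    "h ` (topspace X - (topspace X - {x})) = {1}"
    using assms(1,2) unfolding functionally_ideal_normal_def by meson
  have hx: "h x = 1"
    using h(3) xX by (auto dest: equalityD1)
  have hA: "h z = 0" if "z \<in> A" for z
    using h(2) that by auto
  define g where "g = restrict (\<lambda>z. f z + (c - f x) * h z) (topspace X)"
  have "g \<in> C_set X"
    unfolding g_def using C_set_continuous[OF f] h(1)
    by (intro restrict_in_C_set continuous_map_add continuous_map_real_mult) auto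
  moreover have "\<forall>z\<in>A. g z = f z"
    using hA sub by (auto simp: g_def)
  moreover have "g x = c"
    using hx xX by (simp add: g_def)
  ultimately show ?thesis
    by blast
qed

lemma injectively_discretely_selective_C_ideal:
  assumes "topspace X \<noteq> {}" "proper_closed_ideal X \<I>" "functionally_ideal_normal X \<I>"
    and rb: "\<And>A. A \<in> \<I> \<Longrightarrow> real_bounded_in X A"
    and no_cofinal: "\<And>A :: nat \<Rightarrow> 'a set. range A \<subseteq> \<I> \<Longrightarrow> \<exists>E\<in>\<I>. \<forall>n. \<not> E \<subseteq> A n"
  shows "injectively_discretely_selective (C_ideal X \<I>)"
  unfolding injectively_discretely_selective_def
proof (intro allI impI)
  fix U assume U: "nonempty_open_seq (C_ideal X \<I>) U"
  have ne: "\<I> \<noteq> {}"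
    using assms proper_closed_ideal_nonempty by blast
  have Un: "\<And>A B. A \<in> \<I> \<Longrightarrow> B \<in> \<I> \<Longrightarrow> A \<union> B \<in> \<I>"
    and cl: "\<And>A. A \<in> \<I> \<Longrightarrow> closedin X A"
    and sing: "\<And>x. x \<in> topspace X \<Longrightarrow> {x} \<in> \<I>"
    using assms(2) by (auto simp: proper_closed_ideal_def)
  have sub: "A \<subseteq> topspace X" if "A \<in> \<I>" for A
    using cl that closedin_subset by blast
  have "\<exists>A f \<epsilon>. A \<in> \<I> \<and> f \<in> C_set X \<and> 0 < \<epsilon> \<and> C_nbhd X f A \<epsilon> \<subseteq> U n" for n
  proof -
    have "openin (C_ideal X \<I>) (U n)" and "U n \<noteq> {}"
      using U by (auto simp: nonempty_open_seq_def)
    then show ?thesis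
      using openin_C_ideal[OF ne Un, of X "U n"] by blast
  qed
  then obtain A f \<epsilon> where A: "\<And>n. A n \<in> \<I>" and f: "\<And>n. f n \<in> C_set X"
    and \<epsilon>: "\<And>n. 0 < \<epsilon> n" and fU: "\<And>n. C_nbhd X (f n) (A n) (\<epsilon> n) \<subseteq> U n"
    by metis
  obtain E where E: "E \<in> \<I>" "\<And>n. \<not> E \<subseteq> A n"
    using no_cofinal[of A] A by blast
  \<comment> \<open>Boundedness on \<open>E\<close> serves twice: each chosen function gets a finite
    bound for the next one to exceed, and each candidate accumulation point is bounded
    there.\<close>
  have bounded_E: "\<exists>M. \<forall>x\<in>E. \<bar>g x\<bar> \<le> M" if "g \<in> C_set X" for g
    using rb[OF E(1)] C_set_continuous[OF that] by (auto simp: real_bounded_in_def bounded_iff)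
  \<comment> \<open>\<open>U n\<close> only constrains values on \<open>A n\<close>, so the value at
    a point of \<open>E\<close> outside \<open>A n\<close> is free.\<close>
  have large: "\<exists>g\<in>U n. g \<in> C_set X \<and> (\<exists>x\<in>E. c < g x)" for n c
  proof -
    obtain x where x: "x \<in> E" "x \<notin> A n"
      using E(2) by blast
    then have "closedin X {x}"
      using sub[OF E(1)] cl sing by blast
    then obtain g where g: "g \<in> C_set X" "\<forall>z\<in>A n. g z = f n z" "g x = c + 1"
      using C_set_prescribe_value[OF assms(3) A sub[OF A] _ x(2) f] by meson
    then have "g \<in> C_nbhd X (f n) (A n) (\<epsilon> n)"
      using \<epsilon> by (auto simp: in_C_nbhd_iff)
    then show ?thesis
      using g x fU by force
  qed
  \<comment> \<open>The recursion runs on pairs: a function from \<open>U n\<close> and a bound for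
    it on \<open>E\<close>. By \<open>Q\<close>, the next function exceeds the old bound somewhere
    on \<open>E\<close>, and the bounds grow by at least 1, hence to infinity.\<close>
  define P where "P n p \<longleftrightarrow> fst p \<in> U n \<and> fst p \<in> C_set X \<and> (\<forall>x\<in>E. \<bar>fst p x\<bar> \<le> snd p)"
    for n and p :: "('a \<Rightarrow> real) \<times> real"
  define Q where "Q p q \<longleftrightarrow> (\<exists>x\<in>E. snd p < fst q x) \<and> snd p + 1 \<le> snd q"
    for p q :: "('a \<Rightarrow> real) \<times> real"
  have next_exists: "\<exists>q. P n q \<and> Q p q" for n p
  proof -
    obtain g where g: "g \<in> U n" "g \<in> C_set X" "\<exists>x\<in>E. snd p < g x"
      using large by blast
    obtain M where M: "\<forall>x\<in>E. \<bar>g x\<bar> \<le> M"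
      using bounded_E[OF g(2)] by blast
    have "P n (g, max M (snd p + 1)) \<and> Q p (g, max M (snd p + 1))"
      using g M by (force simp: P_def Q_def)
    then show ?thesis
      by blast
  qed
  then obtain s where s: "\<And>n. P n (s n)" "\<And>n. Q (s n) (s (Suc n))"
    using dependent_nat_choice[of P "\<lambda>_. Q"] by metis
  define y where "y n = fst (s n)" for n
  define M where "M n = snd (s n)" for n
  have y: "y n \<in> U n" "y n \<in> C_set X" and y_le: "\<And>x. x \<in> E \<Longrightarrow> \<bar>y n x\<bar> \<le> M n" for n
    using s(1)[of n] by (auto simp: P_def y_def M_def)
  have y_gt: "\<exists>x\<in>E. M n < y (Suc n) x" and M_Suc: "M n + 1 \<le> M (Suc n)" for n
    using s(2)[of n] by (auto simp: Q_def y_def M_def)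
  have "M n \<le> M (Suc n)" for n
    using M_Suc[of n] by simp
  then have M_mono: "M m \<le> M n" if "m \<le> n" for m n
    using that by (rule lift_Suc_mono_le)
  have M_ge: "M 0 + n \<le> M n" for n
  proof (induction n)
    case (Suc n)
    then show ?case
      using M_Suc[of n] by simp
  qed simp
  \<comment> \<open>\<open>y n\<close> exceeds the bound of its predecessor index \<open>k\<close>,
    and that bound dominates \<open>y m\<close> on \<open>E\<close> because
    \<open>m \<le> k\<close>.\<close>
  have y_neq: "y m \<noteq> y n" if mn: "m < n" for m n
  proof -
    obtain k where k: "n = Suc k" "m \<le> k"
      using mn by (cases n) auto
    obtain x where "x \<in> E" "M k < y n x"
      using y_gt k by blast
    then have "\<bar>y m x\<bar> < y n x"
      using y_le[of x m] M_mono[OF k(2)] by simp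
    then show ?thesis
      by auto
  qed
  have "inj y"
    by (rule injI) (metis y_neq linorder_neqE_nat)
  moreover have "closed_relatively_discrete (C_ideal X \<I>) (range y)"
  proof (rule closed_relatively_discreteI)
    show "t1_space (C_ideal X \<I>)"
      using ne sing by (rule t1_space_C_ideal)
    show "range y \<subseteq> topspace (C_ideal X \<I>)"
      using y by (auto simp: topspace_C_ideal[OF ne])
    fix p assume "p \<in> topspace (C_ideal X \<I>)"
    then have p: "p \<in> C_set X"
      by (simp add: topspace_C_ideal[OF ne])
    obtain K where K: "\<And>x. x \<in> E \<Longrightarrow> \<bar>p x\<bar> \<le> K"
      using bounded_E[OF p] by blast
    \<comment> \<open>Functions within 1 of \<open>p\<close> on \<open>E\<close> are bounded there
      by \<open>K + 1\<close>, and \<open>M N\<close> exceeds this value. For \<open>n > N\<close>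
      the predecessor of \<open>n\<close> is at least \<open>N\<close>, so \<open>y n\<close> is too
      large somewhere on \<open>E\<close>.\<close>
    obtain N :: nat where N: "K + 1 - M 0 < N"
      using reals_Archimedean2 by blast
    have "y n \<notin> C_nbhd X p E 1" if n: "n > N" for n
    proof
      assume "y n \<in> C_nbhd X p E 1"
      then have close: "\<bar>p x - y n x\<bar> \<le> 1" if "x \<in> E" for x
        using that by (force simp: in_C_nbhd_iff)
      obtain k where k: "n = Suc k" "N \<le> k"
        using n by (cases n) auto
      obtain x where x: "x \<in> E" "M k < y n x"
        using y_gt k by blast
      have "real N \<le> real k"
        using k by simp
      then have "K + 1 < y n x"
        using N M_ge[of k] x by linarith
      then show False
        using close[OF x(1)] K[OF x(1)] by linarith
    qed
    then have "C_nbhd X p E 1 \<inter> range y \<subseteq> y ` {..N}"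
    proof (intro subsetI)
      fix g assume g: "g \<in> C_nbhd X p E 1 \<inter> range y"
      then obtain n where n: "g = y n"
        by blast
      have "n \<le> N"
        using \<open>\<And>n. N < n \<Longrightarrow> y n \<notin> C_nbhd X p E 1\<close>[of n] g n by force
      then show "g \<in> y ` {..N}"
        using n by simp
    qed
    then have "finite (C_nbhd X p E 1 \<inter> range y)"
      by (rule finite_surj[OF finite_atMost])
    then show "\<exists>V. openin (C_ideal X \<I>) V \<and> p \<in> V \<and> finite (V \<inter> range y)"
      using in_C_nbhd_self[OF p zero_less_one] openin_C_nbhd[OF p E(1) zero_less_one] by blast
  qed
  ultimately show "\<exists>y. (\<forall>n. y n \<in> U n) \<and> inj y \<and> closed_relatively_discrete (C_ideal X \<I>) (range y)"
    using y by blast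
qed

text \<open>Each \<open>U n\<close> is the complement of one point of \<open>E\<close> missing from
  \<open>A n\<close>, so the same \<open>E\<close> witnesses both conditions. It is nonempty because
  it contains \<open>A n\<close>.\<close>

lemma nonsub_open_nbhds:
  assumes sub: "\<And>A. A \<in> \<I> \<Longrightarrow> closedin X A \<and> A \<noteq> {}"
    and sing: "\<And>x. x \<in> topspace X \<Longrightarrow> closedin X {x}"
    and A: "range A \<subseteq> \<I>" and E: "E \<in> \<I>" "\<And>n::nat. \<not> E \<subseteq> A n"
  shows "\<exists>U. (\<forall>n. openin X (U n) \<and> U n \<noteq> {} \<and> A n \<subseteq> U n) \<and> (\<forall>n. \<not> E \<subseteq> U n)"
proof -
  obtain x where x: "\<And>n. x n \<in> E" "\<And>n. x n \<notin> A n"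
    using E(2) unfolding subset_iff by metis
  have "openin X (topspace X - {x n})" for n
    using sing sub[OF E(1)] x(1) closedin_subset by blast
  moreover have "A n \<subseteq> topspace X - {x n}" "A n \<noteq> {}" for n
    using sub[of "A n"] A x(2) closedin_subset[of X "A n"] by auto
  ultimately show ?thesis
    using x(1) by (intro exI[of _ "\<lambda>n. topspace X - {x n}"]) blast
qed

section \<open>The circle of equivalences\<close>

theorem theorem3p38:
  fixes X :: "'a topology" and \<I> :: "'a set set"
  assumes "topspace X \<noteq> {}"
    and "proper_closed_ideal X \<I>"
    and "functionally_ideal_normal X \<I>"
    and "\<forall>A\<in>\<I>. real_bounded_in X A"
  shows "((\<forall>A :: nat \<Rightarrow> 'a set. range A \<subseteq> \<I> \<longrightarrow> (\<exists>E\<in>\<I>. \<forall>n. \<not> E \<subseteq> A n))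
          \<longleftrightarrow> (\<forall>A :: nat \<Rightarrow> 'a set. range A \<subseteq> \<I> \<longrightarrow>
                (\<exists>U :: nat \<Rightarrow> 'a set. (\<forall>n. openin X (U n) \<and> U n \<noteq> {} \<and> A n \<subseteq> U n) \<and>
                   (\<exists>E\<in>\<I>. \<forall>n. \<not> E \<subseteq> U n))))
       \<and> ((\<forall>A :: nat \<Rightarrow> 'a set. range A \<subseteq> \<I> \<longrightarrow> (\<exists>E\<in>\<I>. \<forall>n. \<not> E \<subseteq> A n))
          \<longleftrightarrow> \<not> first_countable (C_ideal X \<I>))
       \<and> (\<not> first_countable (C_ideal X \<I>) \<longleftrightarrow> \<not> metrizable_space (C_ideal X \<I>))
       \<and> (\<not> metrizable_space (C_ideal X \<I>) \<longleftrightarrow> injectively_discretely_selective (C_ideal X \<I>))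
       \<and> (injectively_discretely_selective (C_ideal X \<I>) \<longleftrightarrow> discretely_selective (C_ideal X \<I>))
       \<and> (discretely_selective (C_ideal X \<I>) \<longleftrightarrow> SHD (C_ideal X \<I>))
       \<and> (SHD (C_ideal X \<I>) \<longleftrightarrow> WSHD (C_ideal X \<I>))"
proof -
  let ?Y = "C_ideal X \<I>"
  have ne: "\<I> \<noteq> {}"
    using assms proper_closed_ideal_nonempty by blast
  have Un: "\<And>A B. A \<in> \<I> \<Longrightarrow> B \<in> \<I> \<Longrightarrow> A \<union> B \<in> \<I>"
    and cl: "\<And>A. A \<in> \<I> \<Longrightarrow> closedin X A \<and> A \<noteq> {}"
    and sing: "\<And>x. x \<in> topspace X \<Longrightarrow> {x} \<in> \<I>"
    using assms(2) by (auto simp: proper_closed_ideal_def)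
  let ?i = "\<forall>A :: nat \<Rightarrow> 'a set. range A \<subseteq> \<I> \<longrightarrow> (\<exists>E\<in>\<I>. \<forall>n. \<not> E \<subseteq> A n)"
  let ?ii = "\<forall>A :: nat \<Rightarrow> 'a set. range A \<subseteq> \<I> \<longrightarrow>
                (\<exists>U :: nat \<Rightarrow> 'a set. (\<forall>n. openin X (U n) \<and> U n \<noteq> {} \<and> A n \<subseteq> U n) \<and>
                   (\<exists>E\<in>\<I>. \<forall>n. \<not> E \<subseteq> U n))"
  obtain f where f: "f \<in> C_set X"
    using restrict_in_C_set[of X "\<lambda>_. 0"] by auto
  have i_ii: "?ii" if i: "?i"
  proof (intro allI impI)
    fix A :: "nat \<Rightarrow> 'a set" assume A: "range A \<subseteq> \<I>"
    then obtain E where E: "E \<in> \<I>" "\<And>n. \<not> E \<subseteq> A n"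
      using i by blast
    then show "\<exists>U. (\<forall>n. openin X (U n) \<and> U n \<noteq> {} \<and> A n \<subseteq> U n) \<and> (\<exists>E\<in>\<I>. \<forall>n. \<not> E \<subseteq> U n)"
      using nonsub_open_nbhds[OF cl _ A E] cl[OF sing] by blast
  qed
  \<comment> \<open>The inclusions \<open>A n \<subseteq> U n\<close> let the witness
    \<open>E\<close> pass from the \<open>U n\<close> to the \<open>A n\<close>.\<close>
  have ii_i: "?i" if ii: "?ii"
  proof (intro allI impI)
    fix A :: "nat \<Rightarrow> 'a set" assume "range A \<subseteq> \<I>"
    with ii have "\<exists>U. (\<forall>n. openin X (U n) \<and> U n \<noteq> {} \<and> A n \<subseteq> U n) \<and> (\<exists>E\<in>\<I>. \<forall>n. \<not> E \<subseteq> U n)"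
      by (elim allE impE)
    then obtain U E where "\<And>n. A n \<subseteq> U n" "E \<in> \<I>" "\<And>n. \<not> E \<subseteq> U n"
      by auto
    then show "\<exists>E\<in>\<I>. \<forall>n. \<not> E \<subseteq> A n"
      by (meson order_trans)
  qed
  \<comment> \<open>By contraposition: a sequence violating the condition is a countable cofinal
    family in the ideal.\<close>
  have not_metrizable_i: "?i" if "\<not> metrizable_space ?Y"
  proof (intro allI impI, rule ccontr)
    fix A :: "nat \<Rightarrow> 'a set" assume A: "range A \<subseteq> \<I>" and "\<not> (\<exists>E\<in>\<I>. \<forall>n. \<not> E \<subseteq> A n)"
    then have cofinal: "\<exists>n. E \<subseteq> A n" if "E \<in> \<I>" for E
      using that by simp
    have "metrizable_space ?Y"
    proof (rule metrizable_C_ideal[OF ne Un _ sing assms(1) _ cofinal])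
      show "E \<subseteq> topspace X" if "E \<in> \<I>" for E
        using cl[OF that] closedin_subset by blast
      show "A n \<in> \<I>" for n
        using A by blast
    qed
    with \<open>\<not> metrizable_space ?Y\<close> show False
      by contradiction
  qed
  have i_inj: "injectively_discretely_selective ?Y" if i: "?i"
    using assms(1-3)
  proof (rule injectively_discretely_selective_C_ideal)
    show "real_bounded_in X A" if "A \<in> \<I>" for A
      using assms(4) that by blast
    show "\<exists>E\<in>\<I>. \<forall>n. \<not> E \<subseteq> A n" if "range A \<subseteq> \<I>" for A :: "nat \<Rightarrow> 'a set"
      using i that by simp
  qed
  have ds_nfc: "\<not> first_countable ?Y" if "discretely_selective ?Y"
    using discretely_selective_imp_not_first_countable[OF that t1_space_C_ideal[OF ne sing]
        derived_set_of_C_ideal[OF ne Un assms(1) f]] by blast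
  have WSHD_nfc: "\<not> first_countable ?Y" if "WSHD ?Y"
    using that f by (intro WSHD_imp_not_first_countable) (auto simp: topspace_C_ideal[OF ne])
  have nfc_nm: "\<not> metrizable_space ?Y" if "\<not> first_countable ?Y"
    using that metrizable_imp_first_countable by blast
  \<comment> \<open>Non-metrizability gives \<open>?i\<close>, which gives injective selections.
    From there one branch goes through discrete selectivity and another through SHD and WSHD; both
    end in failure of first countability, which returns to non-metrizability.\<close>
  note implications = not_metrizable_i i_inj ds_nfc WSHD_nfc nfc_nm
    injectively_discretely_selective_imp_discretely_selective[of ?Y]
    injectively_discretely_selective_imp_SHD[of ?Y] SHD_imp_WSHD[of ?Y]
  have "?i \<longleftrightarrow> ?ii"
    using i_ii ii_i by (rule iffI)
  moreover have "?i \<longleftrightarrow> \<not> first_countable ?Y"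
    using implications by argo
  moreover have "\<not> first_countable ?Y \<longleftrightarrow> \<not> metrizable_space ?Y"
    using implications by argo
  moreover have "\<not> metrizable_space ?Y \<longleftrightarrow> injectively_discretely_selective ?Y"
    using implications by argo
  moreover have "injectively_discretely_selective ?Y \<longleftrightarrow> discretely_selective ?Y"
    using implications by argo
  moreover have "discretely_selective ?Y \<longleftrightarrow> SHD ?Y"
    using implications by argo
  moreover have "SHD ?Y \<longleftrightarrow> WSHD ?Y"
    using implications by argo
  ultimately show ?thesis
    by (intro conjI)
qed

end
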